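(* Let $\varepsilon_0=\log^2(15/2)/72$. For every fixed $\varepsilon$ with $0<\varepsilon\le\varepsilon_0$, there does not exist a constant $C=C(\varepsilon)>0$ such that every sufficiently large $n$-vertex $d$-regular $(\varepsilon,d)$-expander with $d\ge C\log^2 n$ contains a Hamilton cycle. More precisely, for every such $\varepsilon$ there is an infinite sequence of graphs $(G_k)_{k\ge1}$, where $G_k$ is a nonhamiltonian $d_k$-regular $(\varepsilon,d_k)$-expander on $n_k$ vertices, such that, as $k\to\infty$, $n_k\to\infty$, $d_k/n_k\to 0$ and $d_k/\log^2 n_k\to\infty$.
   Context: All graphs are finite, simple and undirected, and all logarithms are natural; $\log^2 y$ means $(\log y)^2$. A Hamilton cycle is a cycle containing every vertex; a graph is hamiltonian if it has a Hamilton cycle, and nonhamiltonian otherwise. For a graph $G$ and $X\subseteq V(G)$, the external neighborhood of $X$ is $N_G(X)=\{v\in V(G)\setminus X : v \text{ has a neighbor in } X\}$. For $\varepsilon>0$ and $k>0$, define $\rho(x;\varepsilon,k)=0$ if $x<k/5$, and $\rho(x;\varepsilon,k)=\dfrac{\varepsilon}{\log^2(15x/k)}$ if $x\ge k/5$. A graph $G$ is an $(\varepsilon,k)$-expander if $|N_G(X)|\ge \rho(|X|;\varepsilon,k)\,|X|$ for every set $X\subseteq V(G)$ with $k/2\le |X|\le |V(G)|/2$. *)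

theory Defs
  imports Complex_Main "Graph_Theory.Pair_Digraph"
begin

text \<open>
  A finite simple undirected graph is a \<^locale>\<open>pair_graph\<close>: a finite vertex set together with
  a symmetric, irreflexive set of arcs. Each undirected edge is represented by its two
  orientations.
\<close>

definition ext_nbhd :: "'a pair_pre_digraph \<Rightarrow> 'a set \<Rightarrow> 'a set" where
  "ext_nbhd G X = {v \<in> pverts G - X. \<exists>u\<in>X. (u, v) \<in> parcs G}"

definition rho :: "real \<Rightarrow> real \<Rightarrow> real \<Rightarrow> real" where
  "rho x \<epsilon> k = (if x < k / 5 then 0 else \<epsilon> / (ln (15 * x / k))\<^sup>2)"

text \<open>The range of the parameters, \<open>\<epsilon> > 0\<close> and \<open>k > 0\<close>, is part of the predicate.\<close>

definition expander :: "real \<Rightarrow> real \<Rightarrow> 'a pair_pre_digraph \<Rightarrow> bool" where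
  "expander \<epsilon> k G \<longleftrightarrow> 0 < \<epsilon> \<and> 0 < k \<and>
     (\<forall>X \<subseteq> pverts G. k / 2 \<le> real (card X) \<and> real (card X) \<le> real (card (pverts G)) / 2 \<longrightarrow>
        rho (real (card X)) \<epsilon> k * real (card X) \<le> real (card (ext_nbhd G X)))"

text \<open>As arcs come in opposite pairs, the out-degree is the degree of the undirected graph.\<close>

definition regular :: "nat \<Rightarrow> 'a pair_pre_digraph \<Rightarrow> bool" where
  "regular d G \<longleftrightarrow> (\<forall>v \<in> pverts G. out_degree (with_proj G) v = d)"

text \<open>
  The library notion of a cycle is the directed one, so in a symmetric digraph it admits the
  closed walk that traverses one edge back and forth; the bound on the length excludes it.
\<close>

definition hamilton_cycle :: "'a pair_pre_digraph \<Rightarrow> ('a \<times> 'a) list \<Rightarrow> bool" where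
  "hamilton_cycle G p \<longleftrightarrow>
     pre_digraph.cycle (with_proj G) p \<and> 3 \<le> length p \<and> fst ` set p = pverts G"

definition hamiltonian :: "'a pair_pre_digraph \<Rightarrow> bool" where
  "hamiltonian G \<longleftrightarrow> (\<exists>p. hamilton_cycle G p)"

end

theory Submission
  imports Defs "HOL-Number_Theory.Cong" "HOL-Library.Countable" "HOL-Analysis.Convex"
    "HOL-Real_Asymp.Real_Asymp"
begin

text \<open>
  For a prime \<open>p\<close> and \<open>d = 4q \<le> p\<close>, the points \<open>(x, y)\<close> and the lines \<open>y = ax + b\<close> over
  \<open>\<int>/p\<close> with \<open>x, a < d\<close> form a \<open>d\<close>-regular bipartite graph without 4-cycles. By Cauchy-Schwarz,
  every set of \<open>s\<close> points or lines has at least \<open>s d\<^sup>2 / (d + s)\<close> neighbours.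
  Delete one line. The \<open>d\<close> points on it now lack one edge each; supply these edges from two
  boxes, each a complete graph on \<open>d + 1\<close> vertices minus a matching on \<open>d/2\<close> of them, whose
  matched vertices are joined to \<open>d/2\<close> of the points. The graph is \<open>d\<close>-regular again.
  Removing all \<open>dp\<close> points leaves \<open>dp - 1\<close> isolated lines and two boxes, which is one
  component too many for a Hamilton cycle. Expansion by the factor \<open>1/72\<close>, which is the largest
  value of \<open>\<rho>\<close> that the bound on \<open>\<epsilon>\<close> allows, comes from the bipartite part unless the set lies
  mostly in the boxes, where it comes from the rest of a box or from the points attached to it.
\<close>

section \<open>Hamilton cycles and vertex cuts\<close>

text \<open>The disjunction is the form that the induction needs: after an arc starting in
  \<open>C\<close>, the rest of the walk starts in \<open>C\<close>. For a closed walk the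
  conclusion puts the base point into \<open>C\<close>, and the next lemma then confines the whole
  walk to \<open>C\<close>.\<close>

lemma pcas_enters_closed_set:
  assumes "pcas u p v" and "u \<in> C \<or> (\<exists>e\<in>set p. fst e \<in> C)"
    and "\<And>e. e \<in> set p \<Longrightarrow> fst e \<in> C \<Longrightarrow> snd e \<in> C"
  shows "v \<in> C"
  using assms by (induction u p v rule: pcas.induct) auto

lemma pcas_stays_in_closed_set:
  assumes "pcas u p v" and "u \<in> C"
    and "\<And>e. e \<in> set p \<Longrightarrow> fst e \<in> C \<Longrightarrow> snd e \<in> C"
  shows "fst ` set p \<subseteq> C"
  using assms by (induction u p v rule: pcas.induct) auto

text \<open>This is the toughness obstruction. A Hamilton cycle has to leave every part, and it can
  leave only into \<open>S\<close>. Disjoint parts are left along different arcs, and the cycle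
  enters each vertex of \<open>S\<close> only once.\<close>

lemma hamiltonian_imp_card_parts_le:
  assumes "hamiltonian G" and S: "finite S"
    and disj: "pairwise disjnt \<C>" and proper: "\<And>C. C \<in> \<C> \<Longrightarrow> C \<noteq> {} \<and> C \<subset> pverts G"
    and exit: "\<And>C u v. C \<in> \<C> \<Longrightarrow> u \<in> C \<Longrightarrow> v \<notin> C \<Longrightarrow> (u, v) \<in> parcs G \<Longrightarrow> v \<in> S"
  shows "card \<C> \<le> card S"
proof -
  obtain p u where p: "pre_digraph.awalk (with_proj G) u p u"
    and dist: "distinct (tl (pre_digraph.awalk_verts (with_proj G) u p))"
    and ne: "p \<noteq> []" and V: "fst ` set p = pverts G"
    using assms(1) unfolding hamiltonian_def hamilton_cycle_def pre_digraph.cycle_def by auto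
  have cas: "pcas u p u" and arcs: "set p \<subseteq> parcs G"
    using p by (auto simp: pre_digraph.awalk_def cas_with_proj_eq)
  have "tl (pre_digraph.awalk_verts (with_proj G) u p) = map snd p"
    using pre_digraph.awalk_verts_conv'[of "with_proj G" u p u] cas ne
    by (simp add: cas_with_proj_eq)
  \<comment> \<open>The vertices of the cycle after the first are the heads of its arcs, so
    distinctness says that no vertex is entered twice.\<close>
  then have inj: "inj_on snd (set p)"
    using dist by (simp add: distinct_map)
  have "\<exists>e\<in>set p. fst e \<in> C \<and> snd e \<notin> C" if C: "C \<in> \<C>" for C
  proof (rule ccontr)
    assume "\<not> ?thesis"
    then have closed: "\<And>e. e \<in> set p \<Longrightarrow> fst e \<in> C \<Longrightarrow> snd e \<in> C" by blast
    obtain w where "w \<in> C" using proper[OF C] by blast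
    then have "w \<in> fst ` set p" using proper[OF C] V by blast
    then have "\<exists>e\<in>set p. fst e \<in> C" using \<open>w \<in> C\<close> by auto
    then have "u \<in> C" using pcas_enters_closed_set[OF cas _ closed] by blast
    then have "fst ` set p \<subseteq> C" using pcas_stays_in_closed_set[OF cas _ closed] by blast
    then show False using proper[OF C] V by blast
  qed
  then obtain f where f: "\<And>C. C \<in> \<C> \<Longrightarrow> f C \<in> set p \<and> fst (f C) \<in> C \<and> snd (f C) \<notin> C"
    by metis
  have "inj_on (snd \<circ> f) \<C>"
  proof (rule comp_inj_on)
    show "inj_on f \<C>"
    proof (rule inj_onI)
      fix C D assume "C \<in> \<C>" "D \<in> \<C>" "f C = f D"
      then have "fst (f C) \<in> C \<inter> D" using f by (metis IntI)
      then show "C = D"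
        using disj \<open>C \<in> \<C>\<close> \<open>D \<in> \<C>\<close> by (auto simp: pairwise_def disjnt_def)
    qed
    show "inj_on snd (f ` \<C>)" using inj f by (meson image_subsetI inj_on_subset)
  qed
  moreover have "(snd \<circ> f) ` \<C> \<subseteq> S"
  proof
    fix v assume "v \<in> (snd \<circ> f) ` \<C>"
    then obtain C where "C \<in> \<C>" "v = snd (f C)" by auto
    then show "v \<in> S"
      using f[of C] arcs exit[of C "fst (f C)" "snd (f C)"] by auto
  qed
  ultimately show ?thesis using card_inj_on_le S by blast
qed

section \<open>Neighbourhoods in bipartite graphs without 4-cycles\<close>

text \<open>Cauchy-Schwarz for the numbers of edges from \<open>A\<close> to the single vertices of \<open>N(A)\<close>.\<close>

lemma card_nbhd_codegree_le_1:
  assumes A: "finite A" and Y: "finite Y"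
    and deg: "\<And>x. x \<in> A \<Longrightarrow> card {y \<in> Y. R x y} = d"
    and codeg: "\<And>x x' y y'. x \<in> A \<Longrightarrow> x' \<in> A \<Longrightarrow> R x y \<Longrightarrow> R x' y \<Longrightarrow> R x y' \<Longrightarrow> R x' y' \<Longrightarrow>
      y \<in> Y \<Longrightarrow> y' \<in> Y \<Longrightarrow> x = x' \<or> y = y'"
  shows "card A * d\<^sup>2 \<le> card {y \<in> Y. \<exists>x\<in>A. R x y} * (d + card A)"
proof (cases "card A = 0")
  case False
  define B where "B = {y \<in> Y. \<exists>x\<in>A. R x y}"
  have B: "finite B" using Y by (simp add: B_def)
  \<comment> \<open>The edges between \<open>A\<close> and its neighbourhood \<open>B\<close> are
    counted from both sides.\<close>
  have "(\<Sum>y\<in>B. card {x \<in> A. R x y}) = (\<Sum>x\<in>A. card {y \<in> B. R x y})"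
    using sum_multicount_gen[OF B A, of "\<lambda>y x. R x y" "\<lambda>x. card {y \<in> B. R x y}"] by simp
  also have "\<dots> = (\<Sum>x\<in>A. d)"
  proof (rule sum.cong)
    fix x assume "x \<in> A"
    then have "{y \<in> B. R x y} = {y \<in> Y. R x y}" by (auto simp: B_def)
    then show "card {y \<in> B. R x y} = d" using deg \<open>x \<in> A\<close> by simp
  qed simp
  finally have s1: "(\<Sum>y\<in>B. card {x \<in> A. R x y}) = card A * d" by simp
  have "(\<Sum>y\<in>B. (card {x \<in> A. R x y})\<^sup>2) = (\<Sum>y\<in>B. card {z \<in> A \<times> A. R (fst z) y \<and> R (snd z) y})"
  proof (rule sum.cong)
    fix y
    have "{z \<in> A \<times> A. R (fst z) y \<and> R (snd z) y} = {x \<in> A. R x y} \<times> {x \<in> A. R x y}" by auto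
    then show "(card {x \<in> A. R x y})\<^sup>2 = card {z \<in> A \<times> A. R (fst z) y \<and> R (snd z) y}"
      by (simp add: card_cartesian_product power2_eq_square)
  qed simp
  also have "\<dots> = (\<Sum>z\<in>A \<times> A. card {y \<in> B. R (fst z) y \<and> R (snd z) y})"
    using sum_multicount_gen[OF B, of "A \<times> A" "\<lambda>y z. R (fst z) y \<and> R (snd z) y"] A by simp
  \<comment> \<open>Two different members of \<open>A\<close> have at most one common neighbour, and
    a diagonal pair has at most \<open>d\<close>. Allowing one more on the diagonal gives the sum a
    closed form.\<close>
  also have "\<dots> \<le> (\<Sum>z\<in>A \<times> A. (if fst z = snd z then d else 0) + 1)"
  proof (rule sum_mono)
    fix z assume z: "z \<in> A \<times> A"
    show "card {y \<in> B. R (fst z) y \<and> R (snd z) y} \<le> (if fst z = snd z then d else 0) + 1"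
    proof (cases "fst z = snd z")
      case True
      have "{y \<in> B. R (fst z) y} \<subseteq> {y \<in> Y. R (fst z) y}" by (auto simp: B_def)
      then have "card {y \<in> B. R (fst z) y} \<le> card {y \<in> Y. R (fst z) y}"
        using Y by (intro card_mono) auto
      then show ?thesis using True z deg[of "fst z"] by auto
    next
      case False
      have "\<forall>y\<in>{y \<in> B. R (fst z) y \<and> R (snd z) y}. \<forall>y'\<in>{y \<in> B. R (fst z) y \<and> R (snd z) y}. y = y'"
        using codeg[of "fst z" "snd z"] z False by (auto simp: B_def)
      then have "card {y \<in> B. R (fst z) y \<and> R (snd z) y} \<le> 1"
        using B by (simp add: card_le_Suc0_iff_eq)
      then show ?thesis by simp
    qed
  qed
  also have "\<dots> = (\<Sum>x\<in>A. \<Sum>x'\<in>A. (if x = x' then d else 0) + 1)"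
    by (simp add: sum.cartesian_product split_beta)
  also have "\<dots> = card A * d + card A * card A"
    by (simp only: sum.distrib sum.delta[OF A] sum.delta'[OF A]) (simp add: sum.distrib)
  finally have s2: "(\<Sum>y\<in>B. (card {x \<in> A. R x y})\<^sup>2) \<le> card A * d + card A * card A" .
  have "(\<Sum>y\<in>B. real (card {x \<in> A. R x y}))\<^sup>2 \<le> (\<Sum>y\<in>B. (real (card {x \<in> A. R x y}))\<^sup>2) * real (card B)"
    by (rule sum_squared_le_sum_of_squares)
  then have "real ((\<Sum>y\<in>B. card {x \<in> A. R x y})\<^sup>2) \<le> real ((\<Sum>y\<in>B. (card {x \<in> A. R x y})\<^sup>2) * card B)"
    by simp
  then have "(card A * d)\<^sup>2 \<le> (\<Sum>y\<in>B. (card {x \<in> A. R x y})\<^sup>2) * card B"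
    unfolding s1 of_nat_le_iff .
  also have "\<dots> \<le> (card A * d + card A * card A) * card B" by (rule mult_right_mono[OF s2]) simp
  finally have "card A * (card A * d\<^sup>2) \<le> card A * (card B * (d + card A))"
    by (simp add: power2_eq_square algebra_simps)
  then show ?thesis using False unfolding B_def by simp
qed simp

section \<open>Numerical estimates\<close>

text \<open>Here \<open>u\<close> and \<open>w\<close> are the sizes of the larger and the smaller
  of the two sides (points and lines) of a set, \<open>M\<close> is the size of the neighbourhood of
  the larger side, and \<open>e\<close> that of the external neighbourhood. The 1 pays for the
  deleted line. For small \<open>u\<close>, \<open>M\<close> is at least 4/3 u + 1, so e \<ge> 4/3 u
  - w, and w \<le> u gives the factor 6. For large \<open>u\<close>, \<open>M\<close> is at least
  d^2 - 2d, while \<open>s\<close> leaves little more than 2/5 d^2 for \<open>w\<close>.\<close>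

lemma core_expansion_arith:
  fixes d u w M e :: real
  assumes d: "100 \<le> d" and wu: "0 \<le> w" "w \<le> u" and u: "d \<le> 10 * u"
    and s: "u + w \<le> d\<^sup>2 + 5 * d + 1"
    and M: "u * d\<^sup>2 \<le> M * (d + u)" and e: "M - 1 - w \<le> e"
  shows "u + w \<le> 6 * e"
\<comment> \<open>With this threshold the quadratic term 4/3 u^2 takes at most 4/5 of u d^2; the
  remaining 1/5 absorbs the lower-order terms.\<close>
proof (cases "u \<le> 3/5 * d\<^sup>2")
  case True
  have pos: "0 < d + u" using d u by auto
  have "100 * d \<le> d\<^sup>2" using d by (simp add: power2_eq_square)
  then have "4/3 * d + 11 \<le> 1/5 * d\<^sup>2" using d by linarith
  then have "u * (4/3 * d + 11) \<le> u * (1/5 * d\<^sup>2)" using wu by (intro mult_left_mono) auto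
  then have h1: "4/3 * (u * d) + 11 * u \<le> 1/5 * (u * d\<^sup>2)" by (simp add: algebra_simps)
  have "u * u \<le> u * (3/5 * d\<^sup>2)" using True wu by (intro mult_left_mono) auto
  then have h2: "u * u \<le> 3/5 * (u * d\<^sup>2)" by (simp add: algebra_simps)
  have "(4/3 * u + 1) * (d + u) = 4/3 * (u * d) + 4/3 * (u * u) + d + u"
    by (simp add: algebra_simps)
  then have "(4/3 * u + 1) * (d + u) \<le> u * d\<^sup>2" using h1 h2 u by linarith
  then have "(4/3 * u + 1) * (d + u) \<le> M * (d + u)" using M by linarith
  then have "4/3 * u + 1 \<le> M" using pos by simp
  then show ?thesis using e wu by linarith
next
  case False
  have pos: "0 < d + u" using d u by auto
  have sq: "100 * d \<le> d\<^sup>2" using d by (simp add: power2_eq_square)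
  have "d * (3/5 * d\<^sup>2) \<le> d * u" using False d by (intro mult_left_mono) auto
  then have "3/5 * (d * d\<^sup>2) \<le> d * u" by (simp add: algebra_simps)
  moreover have "0 \<le> d * d\<^sup>2" "0 \<le> d\<^sup>2" using d by auto
  ultimately have "d * d\<^sup>2 \<le> 2 * d\<^sup>2 + 2 * (d * u)" by linarith
  then have "(d\<^sup>2 - 2 * d) * (d + u) \<le> u * d\<^sup>2" by (simp add: algebra_simps power2_eq_square)
  then have "(d\<^sup>2 - 2 * d) * (d + u) \<le> M * (d + u)" using M by linarith
  then have "d\<^sup>2 - 2 * d \<le> M" using pos by simp
  then show ?thesis using e s sq d False by linarith
qed

text \<open>Adding the two lower bounds on \<open>e\<close> cancels \<open>x\<close> and leaves 2e
  \<ge> d/2 - 1 - a \<ge> 3/10 d - 1, whereas the left-hand side is at most 11/5 d + 2.\<close>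

lemma box_expansion_arith:
  fixes d a x x' e e' :: real
  assumes "100 \<le> d" "0 \<le> a" "0 \<le> e" "x' \<le> d + 1" "x \<le> d + 1" and a: "a \<le> d / 5" and "3 / 20 * d \<le> x"
    and "d - x \<le> e" and "x - d / 2 - 1 - a \<le> e"
  shows "a + x + x' \<le> 72 * e"
  using assms by linarith

section \<open>The graph\<close>

text \<open>
  \<open>Pt (x, y)\<close> and \<open>Ln (a, b)\<close> are points and lines. \<open>Bx i j\<close> is vertex \<open>j\<close> of box \<open>i\<close>; the removed
  matching consists of the pairs \<open>{2m, 2m + 1}\<close> with \<open>m < q\<close>.
\<close>

datatype vertex = Pt "nat \<times> nat" | Ln "nat \<times> nat" | Bx nat nat

instance vertex :: countable
  by countable_datatype

definition incident :: "nat \<Rightarrow> nat \<times> nat \<Rightarrow> nat \<times> nat \<Rightarrow> bool" where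
  "incident p P L \<longleftrightarrow> (fst L * fst P + snd L) mod p = snd P"

text \<open>The points with second coordinate 0 are those on the deleted line
  \<open>Ln (0, 0)\<close>. Box 0 serves the first half of them and box 1 the second half.\<close>

definition attached :: "nat \<Rightarrow> nat \<times> nat \<Rightarrow> nat \<Rightarrow> nat \<Rightarrow> bool" where
  "attached q P i j \<longleftrightarrow> snd P = 0 \<and> j < 2 * q \<and> fst P = 2 * q * i + j"

fun adj :: "nat \<Rightarrow> nat \<Rightarrow> vertex \<Rightarrow> vertex \<Rightarrow> bool" where
  "adj p q (Pt P) (Ln L) = incident p P L"
| "adj p q (Ln L) (Pt P) = incident p P L"
| "adj p q (Pt P) (Bx i j) = attached q P i j"
| "adj p q (Bx i j) (Pt P) = attached q P i j"
| "adj p q (Bx i j) (Bx i' j') =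
     (i = i' \<and> j \<noteq> j' \<and> \<not> (j div 2 = j' div 2 \<and> j < 2 * q \<and> j' < 2 * q))"
| "adj p q _ _ = False"

lemma adj_sym: "adj p q u v \<Longrightarrow> adj p q v u"
  by (cases "(p, q, u, v)" rule: adj.cases) auto

lemma adj_irrefl: "\<not> adj p q u u"
  by (cases u) auto

locale plane_graph =
  fixes p q :: nat
  assumes prime: "prime p" and q_pos: "0 < q" and qp: "4 * q \<le> p"
begin

definition grid :: "(nat \<times> nat) set" where
  "grid = {..<4 * q} \<times> {..<p}"

definition V :: "vertex set" where
  "V = Pt ` grid \<union> Ln ` (grid - {(0, 0)}) \<union> Bx 0 ` {..4 * q} \<union> Bx 1 ` {..4 * q}"

text \<open>The theorem speaks of graphs on \<open>nat\<close>, hence the encoding by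
  \<open>to_nat\<close>; the combinatorics is done on \<open>V\<close>.\<close>

definition H :: "nat pair_pre_digraph" where
  "H = \<lparr>pverts = to_nat ` V, parcs = {(to_nat u, to_nat v) | u v. u \<in> V \<and> v \<in> V \<and> adj p q u v}\<rparr>"

lemma p_pos: "0 < p"
  using prime by (simp add: prime_gt_0_nat)

lemma finite_grid: "finite grid"
  by (simp add: grid_def)

lemma card_grid: "card grid = 4 * q * p"
  by (simp add: grid_def)

lemma origin_in_grid: "(0, 0) \<in> grid"
  using q_pos p_pos by (simp add: grid_def)

lemma V_simps [simp]:
  "Pt P \<in> V \<longleftrightarrow> P \<in> grid"
  "Ln L \<in> V \<longleftrightarrow> L \<in> grid \<and> L \<noteq> (0, 0)"
  "Bx i j \<in> V \<longleftrightarrow> i < 2 \<and> j \<le> 4 * q"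
  by (auto simp: V_def less_2_cases_iff)

lemma finite_V: "finite V"
  by (simp add: V_def finite_grid)

lemma card_V: "card V = 8 * q * p + 8 * q + 1"
proof -
  have g: "0 < card grid" using finite_grid origin_in_grid card_gt_0_iff by blast
  have "card V = card grid + (card grid - 1) + (4 * q + 1) + (4 * q + 1)"
    unfolding V_def
    by (subst card_Un_disjoint; (auto simp: finite_grid)?)+
      (auto simp: card_image inj_on_def finite_grid origin_in_grid card_Diff_singleton)
  then show ?thesis using g by (simp add: card_grid)
qed

section \<open>Incidences modulo a prime\<close>

text \<open>The alternating sum of the four incidence congruences is (a - a') (x - x') = 0 modulo
  \<open>p\<close>. As \<open>p\<close> is prime and all coordinates are below \<open>p\<close>, the
  slopes or the abscissae agree, and then so do the lines or the points.\<close>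

lemma incident_unique:
  assumes "P \<in> grid" "P' \<in> grid" "L \<in> grid" "L' \<in> grid"
    and inc: "incident p P L" "incident p P L'" "incident p P' L" "incident p P' L'"
  shows "P = P' \<or> L = L'"
proof -
  obtain x y x' y' a b a' b' where eqs: "P = (x, y)" "P' = (x', y')" "L = (a, b)" "L' = (a', b')"
    by (metis surj_pair)
  have less: "x < p" "x' < p" "a < p" "a' < p" "y < p" "y' < p" "b < p" "b' < p"
    using assms qp by (auto simp: grid_def eqs)
  have cong: "[int (k * m + l) = int ((k * m + l) mod p)] (mod p)" for k m l
    by (simp add: cong_def of_nat_mod)
  have c: "[int a * x + b = y] (mod p)" "[int a' * x + b' = y] (mod p)"
      "[int a * x' + b = y'] (mod p)" "[int a' * x' + b' = y'] (mod p)"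
    using inc cong[of a x b] cong[of a' x b'] cong[of a x' b] cong[of a' x' b']
    by (simp_all add: incident_def eqs)
  have "[(int a * x + b) - (int a' * x + b') - ((int a * x' + b) - (int a' * x' + b'))
      = (int y - y) - (int y' - y')] (mod p)"
    by (intro cong_diff c)
  moreover have "(int a * x + b) - (int a' * x + b') - ((int a * x' + b) - (int a' * x' + b'))
      = (int a - a') * (int x - x')" by (simp add: algebra_simps)
  ultimately have "int p dvd (int a - a') * (int x - x')"
    by (simp add: cong_0_iff)
  then have "int p dvd int a - a' \<or> int p dvd int x - x'"
    using prime by (simp add: prime_dvd_mult_iff)
  then have "[a = a'] (mod p) \<or> [x = x'] (mod p)"
    by (simp add: cong_iff_dvd_diff flip: cong_int_iff)
  then have "a = a' \<or> x = x'"
    using less cong_less_modulus_unique_nat by blast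
  then show ?thesis
  proof
    assume "x = x'"
    then show ?thesis using inc by (auto simp: eqs incident_def)
  next
    assume "a = a'"
    have "[(int a * x + b) - (int a' * x + b') = int y - y] (mod p)" by (intro cong_diff c)
    then have "[int b = int b'] (mod p)" using \<open>a = a'\<close> by (simp add: cong_iff_dvd_diff)
    then have "b = b'" using less cong_less_modulus_unique_nat by (simp add: cong_int_iff)
    then show ?thesis using \<open>a = a'\<close> by (simp add: eqs)
  qed
qed

lemma card_lines_through:
  assumes "P \<in> grid"
  shows "card {L \<in> grid. incident p P L} = 4 * q"
proof -
  obtain x y where P: "P = (x, y)" and y: "y < p" using assms by (auto simp: grid_def)
  \<comment> \<open>The factor \<open>p - 1\<close> acts as -1 modulo \<open>p\<close>, so
    \<open>g a\<close> is the intercept y - ax without truncated subtraction: each slope admits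
    exactly one line through the point.\<close>
  define g where "g a = (y + (p - 1) * (a * x)) mod p" for a
  have key: "z + (p - 1) * z = p * z" for z
    using p_pos by (cases p) auto
  have "{L \<in> grid. incident p P L} = (\<lambda>a. (a, g a)) ` {..<4 * q}"
  proof (intro equalityI subsetI)
    fix L assume "L \<in> {L \<in> grid. incident p P L}"
    then obtain a b where L: "L = (a, b)" "a < 4 * q" "b < p" "(a * x + b) mod p = y"
      by (auto simp: grid_def incident_def P)
    have "g a = (a * x + b + (p - 1) * (a * x)) mod p"
      unfolding g_def using L(4) by (metis mod_add_left_eq)
    also have "a * x + b + (p - 1) * (a * x) = b + p * (a * x)"
      using key[of "a * x"] by linarith
    finally have "g a = b" using L(3) by simp
    then show "L \<in> (\<lambda>a. (a, g a)) ` {..<4 * q}" using L by auto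
  next
    fix L assume "L \<in> (\<lambda>a. (a, g a)) ` {..<4 * q}"
    then obtain a where L: "L = (a, g a)" "a < 4 * q" by auto
    have "(a * x + g a) mod p = (a * x + (y + (p - 1) * (a * x))) mod p"
      unfolding g_def by (simp add: mod_add_right_eq)
    also have "a * x + (y + (p - 1) * (a * x)) = y + p * (a * x)"
      using key[of "a * x"] by linarith
    finally have "(a * x + g a) mod p = y" using y by simp
    then show "L \<in> {L \<in> grid. incident p P L}"
      using L p_pos by (auto simp: grid_def incident_def P g_def)
  qed
  moreover have "inj_on (\<lambda>a. (a, g a)) {..<4 * q}" by (auto simp: inj_on_def)
  ultimately show ?thesis by (simp add: card_image)
qed

lemma card_points_on:
  assumes "L \<in> grid"
  shows "card {P \<in> grid. incident p P L} = 4 * q"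
proof -
  obtain a b where L: "L = (a, b)" by (cases L)
  have "{P \<in> grid. incident p P L} = (\<lambda>x. (x, (a * x + b) mod p)) ` {..<4 * q}"
    using p_pos by (auto simp: grid_def incident_def L)
  moreover have "inj_on (\<lambda>x. (x, (a * x + b) mod p)) {..<4 * q}" by (auto simp: inj_on_def)
  ultimately show ?thesis by (simp add: card_image)
qed

section \<open>Regularity\<close>

text \<open>Losses and gains balance: a point on the deleted line gains one box vertex, and a
  matched box vertex gains one point in place of its partner.\<close>

lemma card_nbrs:
  assumes "u \<in> V"
  shows "card {v \<in> V. adj p q u v} = 4 * q"
proof (cases u)
  case (Pt P)
  then have P: "P \<in> grid" using assms by simp
  obtain x y where xy: "P = (x, y)" "x < 4 * q" "y < p" using P by (auto simp: grid_def)
  show ?thesis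
  proof (cases "y = 0")
    case False
    have "{v \<in> V. adj p q u v} = Ln ` {L \<in> grid. incident p P L}"
      using False Pt xy by (auto simp: V_def attached_def incident_def)
    then show ?thesis using card_lines_through[OF P] by (simp add: card_image inj_on_def)
  next
    case True
    \<comment> \<open>Division by \<open>2 * q\<close> finds the box and the position of the one box
      vertex attached to \<open>(x, 0)\<close>.\<close>
    have j: "x mod (2 * q) < 2 * q" "x mod (2 * q) \<le> 4 * q" "x div (2 * q) < 2" "x = 2 * q * (x div (2 * q)) + x mod (2 * q)"
      using q_pos xy mod_less_divisor[of "2 * q" x]
      by (auto simp: less_mult_imp_div_less simp del: mod_less_divisor)
    have "{v \<in> V. adj p q u v}
        = insert (Bx (x div (2 * q)) (x mod (2 * q))) (Ln ` ({L \<in> grid. incident p P L} - {(0, 0)}))"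
    proof (intro equalityI subsetI)
      fix v assume v: "v \<in> {v \<in> V. adj p q u v}"
      show "v \<in> insert (Bx (x div (2 * q)) (x mod (2 * q))) (Ln ` ({L \<in> grid. incident p P L} - {(0, 0)}))"
        using v Pt q_pos by (cases v) (auto simp: attached_def xy)
    next
      fix v assume "v \<in> insert (Bx (x div (2 * q)) (x mod (2 * q))) (Ln ` ({L \<in> grid. incident p P L} - {(0, 0)}))"
      then show "v \<in> {v \<in> V. adj p q u v}"
        using j Pt True xy by (auto simp: attached_def simp del: mod_less_divisor)
    qed
    moreover have "(0, 0) \<in> {L \<in> grid. incident p P L}"
      using origin_in_grid xy True by (simp add: incident_def)
    moreover have "Bx i j \<notin> Ln ` S" for i j S by auto
    ultimately have "card {v \<in> V. adj p q u v} = Suc (card {L \<in> grid. incident p P L} - 1)"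
      by (simp add: finite_grid card_image inj_on_def card_Diff_singleton)
    then show ?thesis using card_lines_through[OF P] q_pos by simp
  qed
next
  case (Ln L)
  then have L: "L \<in> grid" using assms by simp
  have "{v \<in> V. adj p q u v} = Pt ` {P \<in> grid. incident p P L}"
    using Ln by (auto simp: V_def)
  then show ?thesis using card_points_on[OF L] by (simp add: card_image inj_on_def)
next
  case (Bx i j)
  then have i: "i < 2" and j: "j \<le> 4 * q" using assms by auto
  show ?thesis
  proof (cases "j < 2 * q")
    case False
    have "{v \<in> V. adj p q u v} = Bx i ` ({..4 * q} - {j})"
    proof (intro equalityI subsetI)
      fix v assume v: "v \<in> {v \<in> V. adj p q u v}"
      then show "v \<in> Bx i ` ({..4 * q} - {j})"
        using Bx False by (cases v) (auto simp: attached_def)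
    qed (use Bx False i in auto)
    then show ?thesis using j by (simp add: card_image inj_on_def card_Diff_singleton)
  next
    case True
    \<comment> \<open>The partner of \<open>j\<close> in the removed matching; it stays below
      \<open>2 * q\<close> because that number is even.\<close>
    define j' where "j' = (if even j then j + 1 else j - 1)"
    have j': "j' < 2 * q" "j' \<noteq> j" "k div 2 = j div 2 \<longleftrightarrow> k = j \<or> k = j'" for k
      unfolding j'_def using True by (auto elim!: evenE oddE)
    have j'': "j div 2 = k div 2 \<longleftrightarrow> k = j \<or> k = j'" for k
      using j'(3)[of k] by (subst eq_commute)
    define P where "P = (2 * q * i + j, 0::nat)"
    have P: "P \<in> grid" using i True p_pos by (auto simp: P_def grid_def less_2_cases_iff)
    have "{v \<in> V. adj p q u v} = insert (Pt P) (Bx i ` ({..4 * q} - {j, j'}))"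
    proof (intro equalityI subsetI)
      fix v assume v: "v \<in> {v \<in> V. adj p q u v}"
      then show "v \<in> insert (Pt P) (Bx i ` ({..4 * q} - {j, j'}))"
        using Bx True j'(1,2) by (cases v) (auto simp: attached_def P_def prod_eq_iff j'')
    next
      fix v assume "v \<in> insert (Pt P) (Bx i ` ({..4 * q} - {j, j'}))"
      then show "v \<in> {v \<in> V. adj p q u v}"
        using Bx True i P by (auto simp: attached_def P_def j'')
    qed
    moreover have "card ({..4 * q} - {j, j'}) = 4 * q + 1 - 2"
      using j' j True by (subst card_Diff_subset) auto
    moreover have "Pt P \<notin> Bx i ` S" for S by auto
    ultimately show ?thesis using q_pos by (simp add: card_image inj_on_def)
  qed
qed

lemma arc_iff:
  "(to_nat u, to_nat v) \<in> parcs H \<longleftrightarrow> u \<in> V \<and> v \<in> V \<and> adj p q u v"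
  by (auto simp: H_def)

lemma pverts_H: "pverts H = to_nat ` V"
  by (simp add: H_def)

lemma card_pverts_H: "card (pverts H) = 8 * q * p + 8 * q + 1"
  by (simp add: pverts_H card_image card_V inj_on_def)

lemma pair_graph_H: "pair_graph H"
proof
  show "finite (pverts H)" by (simp add: pverts_H finite_V)
  have "parcs H \<subseteq> pverts H \<times> pverts H" by (auto simp: H_def)
  then show "finite (parcs H)"
    using finite_subset[OF _ finite_cartesian_product] \<open>finite (pverts H)\<close> by blast
  show "symmetric (with_proj H)"
    by (auto simp: symmetric_def H_def sym_def intro: adj_sym)
qed (auto simp: H_def adj_irrefl)

lemma regular_H: "regular (4 * q) H"
  unfolding regular_def
proof
  fix w assume "w \<in> pverts H"
  then obtain u where u: "u \<in> V" "w = to_nat u" by (auto simp: pverts_H)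
  have "out_arcs (with_proj H) w = (\<lambda>v. (to_nat u, to_nat v)) ` {v \<in> V. adj p q u v}"
    using u by (auto simp: out_arcs_def H_def)
  then have "out_degree (with_proj H) w = card {v \<in> V. adj p q u v}"
    by (simp add: out_degree_def card_image inj_on_def)
  then show "out_degree (with_proj H) w = 4 * q" using card_nbrs u by simp
qed

section \<open>Nonhamiltonicity\<close>

lemma not_hamiltonian_H: "\<not> hamiltonian H"
proof
  assume ham: "hamiltonian H"
  define parts where "parts = (\<lambda>L. {Ln L}) ` (grid - {(0, 0)}) \<union> {Bx 0 ` {..4 * q}, Bx 1 ` {..4 * q}}"
  have ne: "Bx 0 ` {..4 * q} \<noteq> Bx 1 ` {..4 * q}"
    by (metis atMost_iff image_iff le0 vertex.inject(3) zero_neq_one)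
  have parts_V: "C \<noteq> {} \<and> C \<subseteq> V - Pt ` grid" if "C \<in> parts" for C
    using that q_pos unfolding parts_def by (elim UnE imageE insertE emptyE) auto
  have "card parts = card ((\<lambda>L. {Ln L}) ` (grid - {(0, 0)})) + card {Bx 0 ` {..4 * q}, Bx 1 ` {..4 * q}}"
    unfolding parts_def using finite_grid by (intro card_Un_disjoint) auto
  also have "\<dots> = card grid - 1 + 2"
    using ne by (simp add: card_image inj_on_def finite_grid origin_in_grid card_Diff_singleton)
  finally have "card parts > card grid" by linarith
  moreover have "card ((`) to_nat ` parts) \<le> card (to_nat ` Pt ` grid)"
  proof (rule hamiltonian_imp_card_parts_le[OF ham])
    show "finite (to_nat ` Pt ` grid)" by (simp add: finite_grid)
    have "pairwise disjnt parts"
      unfolding parts_def by (rule pairwiseI) (auto simp: disjnt_def)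
    then show "pairwise disjnt ((`) to_nat ` parts)"
      unfolding pairwise_image by (rule pairwise_mono) (auto simp: disjnt_def)
  next
    fix C assume "C \<in> (`) to_nat ` parts"
    then obtain D where D: "D \<in> parts" "C = to_nat ` D" by blast
    \<comment> \<open>No part contains a point, so any point shows that the part is a proper
      subset.\<close>
    have "Pt (0, 0) \<in> V" by (simp add: origin_in_grid)
    moreover have "Pt (0, 0) \<notin> D" using parts_V[OF D(1)] origin_in_grid by blast
    ultimately have "D \<subset> V" using parts_V[OF D(1)] by blast
    then have "to_nat ` D \<subset> to_nat ` V" by (intro image_strict_mono) (auto intro: inj_onI)
    then show "C \<noteq> {} \<and> C \<subset> pverts H"
      using parts_V[OF D(1)] by (simp add: pverts_H D(2))
  next
    fix C x y assume C: "C \<in> (`) to_nat ` parts" "x \<in> C" "y \<notin> C" "(x, y) \<in> parcs H"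
    obtain u v where uv: "x = to_nat u" "y = to_nat v" "u \<in> V" "v \<in> V" "adj p q u v"
      using C(4) by (auto simp: H_def)
    obtain D where D: "D \<in> parts" "C = to_nat ` D" using C(1) by blast
    then have "u \<in> D" "v \<notin> D" using C(2,3) uv(1,2) by auto
    consider (line) L where "D = {Ln L}" "L \<in> grid - {(0, 0)}" | (box) i where "D = Bx i ` {..4 * q}"
      using D(1) unfolding parts_def by blast
    then have "v \<in> Pt ` grid"
    proof cases
      case line
      then show ?thesis using \<open>u \<in> D\<close> uv by (cases v) auto
    next
      case box
      then obtain j where "u = Bx i j" using \<open>u \<in> D\<close> by blast
      then show ?thesis using \<open>v \<notin> D\<close> uv box by (cases v) auto
    qed
    then show "y \<in> to_nat ` Pt ` grid" using uv(2) by blast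
  qed
  moreover have "card ((`) to_nat ` parts) = card parts"
    by (rule card_image) (meson inj_image_eq_iff inj_onI inj_to_nat)
  moreover have "card (to_nat ` Pt ` grid) = card grid"
    by (simp add: card_image inj_on_def)
  ultimately show False by linarith
qed

section \<open>Expansion\<close>

lemma ext_nbhd_H:
  assumes "X \<subseteq> V"
  shows "ext_nbhd H (to_nat ` X) = to_nat ` {v \<in> V - X. \<exists>u\<in>X. adj p q u v}"
proof -
  have "to_nat v \<in> to_nat ` X \<longleftrightarrow> v \<in> X" for v by auto
  then show ?thesis using assms unfolding ext_nbhd_def pverts_H
    by (auto simp: arc_iff bex_simps) (use arc_iff in blast)+
qed

text \<open>Points and lines are counted in the full grid, where all degrees equal
  \<open>4 * q\<close>; the deleted line is accounted for on passing to \<open>H\<close>.\<close>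

lemma card_nbrs_of_points:
  assumes A: "A \<subseteq> grid"
  shows "card A * (4 * q)\<^sup>2 \<le> card {L \<in> grid. \<exists>P\<in>A. incident p P L} * (4 * q + card A)"
proof (rule card_nbhd_codegree_le_1)
  show "finite A" using A finite_grid finite_subset by blast
  show "card {L \<in> grid. incident p P L} = 4 * q" if "P \<in> A" for P
    using card_lines_through A that by blast
  show "P = P' \<or> L = L'"
    if "P \<in> A" "P' \<in> A" "incident p P L" "incident p P' L" "incident p P L'" "incident p P' L'"
      "L \<in> grid" "L' \<in> grid" for P P' L L'
    using incident_unique[of P P' L L'] A that by blast
qed (rule finite_grid)

lemma card_nbrs_of_lines:
  assumes A: "A \<subseteq> grid"
  shows "card A * (4 * q)\<^sup>2 \<le> card {P \<in> grid. \<exists>L\<in>A. incident p P L} * (4 * q + card A)"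
proof (rule card_nbhd_codegree_le_1)
  show "finite A" using A finite_grid finite_subset by blast
  show "card {P \<in> grid. incident p P L} = 4 * q" if "L \<in> A" for L
    using card_points_on A that by blast
  show "L = L' \<or> P = P'"
    if "L \<in> A" "L' \<in> A" "incident p P L" "incident p P L'" "incident p P' L" "incident p P' L'"
      "P \<in> grid" "P' \<in> grid" for P P' L L'
    using incident_unique[of P P' L L'] A that by blast
qed (rule finite_grid)

text \<open>A single box vertex in \<open>X\<close> is adjacent to the whole box except itself and
  at most one partner, so at most one box vertex outside \<open>X\<close> fails to be an external
  neighbour.\<close>

lemma card_box_le_card_ext:
  assumes X: "X \<subseteq> V" and i: "i < 2" and ne: "{j. Bx i j \<in> X} \<noteq> {}"
  shows "4 * q \<le> card {v \<in> V - X. \<exists>u\<in>X. adj p q u v} + card {j. Bx i j \<in> X}"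
proof -
  define J where "J = {j. Bx i j \<in> X}"
  obtain j where j: "j \<in> J" using ne by (auto simp: J_def)
  have J: "J \<subseteq> {..4 * q}" using X by (auto simp: J_def)
  have fin: "finite J" using J finite_subset by blast
  \<comment> \<open>For an unmatched \<open>j\<close> this is no real partner; excluding it anyway
    costs at most one vertex.\<close>
  define j' where "j' = (if even j then j + 1 else j - 1)"
  have j': "j div 2 = k div 2 \<longleftrightarrow> k = j \<or> k = j'" for k
    unfolding j'_def by (auto elim!: evenE oddE)
  have "Bx i ` ({..4 * q} - insert j' J) \<subseteq> {v \<in> V - X. \<exists>u\<in>X. adj p q u v}"
  proof
    fix v assume "v \<in> Bx i ` ({..4 * q} - insert j' J)"
    then obtain k where k: "v = Bx i k" "k \<le> 4 * q" "k \<noteq> j'" "k \<notin> J" by auto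
    have "k \<noteq> j" using k j by blast
    then have "adj p q (Bx i j) v" using k j'[of k] by simp
    moreover have "v \<in> V - X" "Bx i j \<in> X" using k j i by (auto simp: J_def)
    ultimately show "v \<in> {v \<in> V - X. \<exists>u\<in>X. adj p q u v}" by blast
  qed
  then have "card (Bx i ` ({..4 * q} - insert j' J)) \<le> card {v \<in> V - X. \<exists>u\<in>X. adj p q u v}"
    using finite_V by (intro card_mono) auto
  moreover have "card (Bx i ` ({..4 * q} - insert j' J)) = card ({..4 * q} - insert j' J)"
    by (simp add: card_image inj_on_def)
  moreover have "card {..4 * q} - card (insert j' J) \<le> card ({..4 * q} - insert j' J)"
    using fin by (intro diff_card_le_card_Diff) auto
  moreover have "card (insert j' J) \<le> card J + 1"
    using fin by (simp add: card_insert_if)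
  ultimately have "4 * q \<le> card {v \<in> V - X. \<exists>u\<in>X. adj p q u v} + card J" by simp
  then show ?thesis by (simp add: J_def)
qed

text \<open>Matched box vertices in \<open>X\<close> have distinct attached points, each of which is
  in \<open>X\<close> or an external neighbour. The term \<open>2 * q + 1\<close> counts the
  unmatched vertices of the box.\<close>

lemma card_box_le_card_attached:
  assumes X: "X \<subseteq> V" and i: "i < 2"
  shows "card {j. Bx i j \<in> X}
    \<le> card {v \<in> V - X. \<exists>u\<in>X. adj p q u v} + (2 * q + 1) + card {P. Pt P \<in> X}"
proof -
  define J where "J = {j. Bx i j \<in> X}"
  have J: "J \<subseteq> {..4 * q}" using X by (auto simp: J_def)
  have fin: "finite J" using J finite_subset by blast
  have finA: "finite {P. Pt P \<in> X}"
    by (rule finite_subset[of _ grid]) (use X finite_grid in auto)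
  define f where "f j = Pt (2 * q * i + j, 0)" for j
  have "f ` (J \<inter> {..<2 * q}) - Pt ` {P. Pt P \<in> X} \<subseteq> {v \<in> V - X. \<exists>u\<in>X. adj p q u v}"
  proof
    fix v assume v: "v \<in> f ` (J \<inter> {..<2 * q}) - Pt ` {P. Pt P \<in> X}"
    then obtain j where j: "v = f j" "j \<in> J" "j < 2 * q" by auto
    have "adj p q (Bx i j) v" using j by (simp add: f_def attached_def)
    moreover have "v \<in> V" using i j p_pos by (auto simp: f_def grid_def less_2_cases_iff)
    moreover have "v \<notin> X" using v j by (auto simp: f_def)
    ultimately show "v \<in> {v \<in> V - X. \<exists>u\<in>X. adj p q u v}" using j by (auto simp: J_def)
  qed
  then have "card (f ` (J \<inter> {..<2 * q}) - Pt ` {P. Pt P \<in> X}) \<le> card {v \<in> V - X. \<exists>u\<in>X. adj p q u v}"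
    using finite_V by (intro card_mono) auto
  moreover have "card (f ` (J \<inter> {..<2 * q})) - card (Pt ` {P. Pt P \<in> X})
      \<le> card (f ` (J \<inter> {..<2 * q}) - Pt ` {P. Pt P \<in> X})"
    using finA by (intro diff_card_le_card_Diff) auto
  moreover have "card (f ` (J \<inter> {..<2 * q})) = card (J \<inter> {..<2 * q})"
    by (simp add: card_image inj_on_def f_def)
  moreover have "card (Pt ` {P. Pt P \<in> X}) = card {P. Pt P \<in> X}"
    by (simp add: card_image inj_on_def)
  moreover have "card J \<le> card (J \<inter> {..<2 * q}) + card {2 * q..4 * q}"
  proof -
    have "card J \<le> card (J \<inter> {..<2 * q} \<union> {2 * q..4 * q})"
      using J by (intro card_mono) auto
    then show ?thesis using card_Un_le le_trans by blast
  qed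
  ultimately have "card J \<le> card {v \<in> V - X. \<exists>u\<in>X. adj p q u v} + (2 * q + 1) + card {P. Pt P \<in> X}"
    by simp
  then show ?thesis by (simp add: J_def)
qed

text \<open>The bound on \<open>p\<close> keeps half of the vertex set near d^2, within reach of the
  Cauchy-Schwarz bound. The cases depend on whether \<open>X\<close> has at least d/5 points and
  lines.\<close>

lemma card_le_72_card_ext:
  assumes q: "25 \<le> q" and p: "p \<le> 4 * q + 4"
    and X: "X \<subseteq> V" and lower: "2 * q \<le> card X" and upper: "2 * card X \<le> card V"
  shows "card X \<le> 72 * card {v \<in> V - X. \<exists>u\<in>X. adj p q u v}"
proof -
  define E where "E = {v \<in> V - X. \<exists>u\<in>X. adj p q u v}"
  define A where "A = {P. Pt P \<in> X}"
  define B where "B = {L. Ln L \<in> X}"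
  define J where "J i = {j. Bx i j \<in> X}" for i
  define NA where "NA = {L \<in> grid. \<exists>P\<in>A. incident p P L}"
  define NB where "NB = {P \<in> grid. \<exists>L\<in>B. incident p P L}"
  have A: "A \<subseteq> grid" and B: "B \<subseteq> grid" and J: "J i \<subseteq> {..4 * q}" for i
    using X by (auto simp: A_def B_def J_def)
  have fin: "finite A" "finite B" "finite (J i)" "finite E" for i
    using finite_subset[OF A finite_grid] finite_subset[OF B finite_grid] finite_subset[OF J]
    by (auto simp: E_def finite_V)
  have X_eq: "X = (Pt ` A \<union> Ln ` B) \<union> (Bx 0 ` J 0 \<union> Bx 1 ` J 1)" (is "_ = ?R")
  proof (intro equalityI subsetI)
    fix v assume v: "v \<in> X"
    show "v \<in> ?R"
    proof (cases v)
      case (Bx i j)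
      then have "Bx i j \<in> V" using v X by blast
      then have "i = 0 \<or> i = 1" by (auto simp: less_2_cases_iff)
      then show ?thesis using v Bx by (auto simp: J_def)
    qed (use v in \<open>auto simp: A_def B_def\<close>)
  qed (auto simp: A_def B_def J_def)
  have card_X: "card X = card A + card B + card (J 0) + card (J 1)"
  proof -
    have "card ?R = card (Pt ` A \<union> Ln ` B) + card (Bx 0 ` J 0 \<union> Bx 1 ` J 1)"
      using fin by (intro card_Un_disjoint) auto
    also have "card (Pt ` A \<union> Ln ` B) = card (Pt ` A) + card (Ln ` B)"
      using fin by (intro card_Un_disjoint) auto
    also have "card (Bx 0 ` J 0 \<union> Bx 1 ` J 1) = card (Bx 0 ` J 0) + card (Bx 1 ` J 1)"
      using fin by (intro card_Un_disjoint) auto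
    finally show ?thesis using X_eq by (simp add: card_image inj_on_def)
  qed
  have "Ln ` (NA - insert (0, 0) B) \<subseteq> E"
  proof
    fix v assume "v \<in> Ln ` (NA - insert (0, 0) B)"
    then obtain L P where L: "v = Ln L" "L \<in> grid" "L \<noteq> (0, 0)" "L \<notin> B" "P \<in> A" "incident p P L"
      by (auto simp: NA_def)
    then have "adj p q (Pt P) v" "Pt P \<in> X" "v \<in> V - X" by (simp_all add: A_def B_def)
    then show "v \<in> E" unfolding E_def by blast
  qed
  then have "card (NA - insert (0, 0) B) \<le> card E"
    using card_inj_on_le[of Ln "NA - insert (0, 0) B" E] fin by (auto simp: inj_on_def)
  moreover have "card NA - card (insert (0, 0) B) \<le> card (NA - insert (0, 0) B)"
    using fin by (intro diff_card_le_card_Diff) auto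
  \<comment> \<open>The extra 1 is the deleted line, which may lie in \<open>NA\<close> but is no
    vertex of \<open>H\<close>.\<close>
  moreover have "card (insert (0, 0) B) \<le> card B + 1"
    using fin by (simp add: card_insert_if)
  ultimately have eA: "card NA \<le> card E + card B + 1" by linarith
  have "Pt ` (NB - A) \<subseteq> E"
  proof
    fix v assume "v \<in> Pt ` (NB - A)"
    then obtain P L where P: "v = Pt P" "P \<in> grid" "P \<notin> A" "L \<in> B" "incident p P L"
      by (auto simp: NB_def)
    then have "adj p q (Ln L) v" "Ln L \<in> X" "v \<in> V - X" by (simp_all add: A_def B_def)
    then show "v \<in> E" unfolding E_def by blast
  qed
  then have "card (NB - A) \<le> card E"
    using card_inj_on_le[of Pt "NB - A" E] fin by (auto simp: inj_on_def)
  moreover have "card NB - card A \<le> card (NB - A)"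
    using fin by (intro diff_card_le_card_Diff) auto
  ultimately have eB: "card NB \<le> card E + card A" by linarith
  define d where "d = real (4 * q)"
  have d: "100 \<le> d" using q by (simp add: d_def)
  have NA: "real (card A) * d\<^sup>2 \<le> real (card NA) * (d + card A)"
    using card_nbrs_of_points[OF A] unfolding NA_def[symmetric] d_def
    by (simp only: of_nat_mult[symmetric] of_nat_add[symmetric] of_nat_power[symmetric] of_nat_le_iff)
  have NB: "real (card B) * d\<^sup>2 \<le> real (card NB) * (d + card B)"
    using card_nbrs_of_lines[OF B] unfolding NB_def[symmetric] d_def
    by (simp only: of_nat_mult[symmetric] of_nat_add[symmetric] of_nat_power[symmetric] of_nat_le_iff)
  have Jle: "real (card (J i)) \<le> d + 1" for i
    using card_mono[OF _ J[of i]] by (simp add: d_def)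
  have "4 * q * p \<le> 4 * q * (4 * q + 4)" using p by (rule mult_left_mono) simp
  then have "card X \<le> 4 * q * (4 * q + 4) + 4 * q"
    using upper card_V by linarith
  then have "real (card X) \<le> real (4 * q * (4 * q + 4) + 4 * q)" by (simp only: of_nat_le_iff)
  then have up: "real (card X) \<le> d\<^sup>2 + 5 * d"
    by (simp add: d_def power2_eq_square algebra_simps)
  have low: "d / 2 \<le> real (card X)" using lower by (simp add: d_def)
  have Xr: "real (card X) = real (card A) + card B + card (J 0) + card (J 1)"
    using card_X by simp
  have "real (card X) \<le> 72 * real (card E)"
  proof (cases "d / 5 \<le> real (card A) + card B")
    case True
    have "real (card A) + card B \<le> 6 * real (card E)"
    proof (cases "card B \<le> card A")
      case True
      show ?thesis
        by (rule core_expansion_arith[OF d _ _ _ _ NA])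
          (use True \<open>d / 5 \<le> _\<close> up Xr eA in auto)
    next
      case False
      have "real (card B) + card A \<le> 6 * real (card E)"
        by (rule core_expansion_arith[OF d _ _ _ _ NB])
          (use False \<open>d / 5 \<le> _\<close> up Xr eB in auto)
      then show ?thesis by simp
    qed
    \<comment> \<open>The boxes add at most 2d + 2 \<le> 11 d/5 vertices, so \<open>X\<close> has at
      most 12 times as many vertices as its bipartite part, and 12 times 6 is 72.\<close>
    then show ?thesis using True Xr Jle[of 0] Jle[of 1] d by linarith
  next
    case False
    define i where "i = (if card (J 1) \<le> card (J 0) then 0 else 1::nat)"
    have i: "i < 2" "card (J 0) \<le> card (J i)" "card (J 1) \<le> card (J i)"
        "card X = card A + card B + card (J i) + card (J (1 - i))"
      by (auto simp: i_def card_X)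
    \<comment> \<open>The boxes hold at least d/2 - d/5 vertices of \<open>X\<close>, and the fuller
      box \<open>i\<close> at least half of these.\<close>
    have large: "3 / 20 * d \<le> card (J i)" using False low Xr i by linarith
    then have "J i \<noteq> {}" using d by auto
    then have e1: "4 * q \<le> card E + card (J i)"
      using card_box_le_card_ext[OF X i(1)] by (simp add: J_def E_def)
    have e2: "card (J i) \<le> card E + (2 * q + 1) + card A"
      using card_box_le_card_attached[OF X i(1)] by (simp add: J_def E_def A_def)
    have "real (card A + card B) + card (J i) + card (J (1 - i)) \<le> 72 * real (card E)"
      by (rule box_expansion_arith[OF d]) (use Jle large False e1 e2 in \<open>auto simp: d_def\<close>)
    then show ?thesis using i(4) by simp
  qed
  then show ?thesis unfolding E_def by linarith
qed

text \<open>For sets of at least k/2 vertices the argument of the logarithm in \<open>rho\<close> is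
  at least 15/2, so \<open>rho\<close> is at most 1/72 by the bound on \<epsilon>.\<close>

lemma expander_H:
  assumes q: "25 \<le> q" and p: "p \<le> 4 * q + 4"
    and \<epsilon>: "0 < \<epsilon>" "\<epsilon> \<le> (ln (15 / 2))\<^sup>2 / 72"
  shows "expander \<epsilon> (real (4 * q)) H"
  unfolding expander_def
proof (intro conjI allI impI)
  show "0 < real (4 * q)" using q_pos by simp
  fix Y assume Y: "Y \<subseteq> pverts H"
    and b: "real (4 * q) / 2 \<le> real (card Y) \<and> real (card Y) \<le> real (card (pverts H)) / 2"
  obtain X where X: "X \<subseteq> V" "Y = to_nat ` X"
    using Y unfolding pverts_H by (auto simp: subset_image_iff)
  have cards: "card Y = card X" "card (pverts H) = card V"
    by (simp_all add: X pverts_H card_image inj_on_def)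
  have "card X \<le> 72 * card {v \<in> V - X. \<exists>u\<in>X. adj p q u v}"
    using b unfolding cards by (intro card_le_72_card_ext[OF q p X(1)]) linarith+
  also have "\<dots> = 72 * card (ext_nbhd H Y)"
    unfolding X(2) ext_nbhd_H[OF X(1)] by (simp add: card_image inj_on_def)
  finally have main: "real (card Y) \<le> 72 * real (card (ext_nbhd H Y))"
    unfolding cards by linarith
  have "15 / 2 \<le> 15 * real (card Y) / real (4 * q)"
    using b q_pos by (simp add: field_simps)
  then have "ln (15 / 2) \<le> ln (15 * real (card Y) / real (4 * q))"
    by (subst ln_le_cancel_iff) auto
  then have ln: "(ln (15 / 2))\<^sup>2 \<le> (ln (15 * real (card Y) / real (4 * q)))\<^sup>2"
    by (intro power_mono) auto
  have pos: "0 < (ln (15 / 2 :: real))\<^sup>2" by simp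
  have "\<epsilon> / (ln (15 * real (card Y) / real (4 * q)))\<^sup>2 \<le> ((ln (15 / 2))\<^sup>2 / 72) / (ln (15 / 2))\<^sup>2"
    using \<epsilon> ln pos by (intro frac_le) auto
  then have "rho (real (card Y)) \<epsilon> (real (4 * q)) \<le> 1 / 72"
    using pos by (simp add: rho_def)
  then have "rho (real (card Y)) \<epsilon> (real (4 * q)) * real (card Y) \<le> 1 / 72 * real (card Y)"
    by (intro mult_right_mono) auto
  then show "rho (real (card Y)) \<epsilon> (real (4 * q)) * real (card Y) \<le> real (card (ext_nbhd H Y))"
    using main by linarith
qed (rule \<epsilon>)

end

section \<open>The sequence of graphs\<close>

theorem corollary1p4:
  fixes \<epsilon> :: real
  assumes "0 < \<epsilon>" and "\<epsilon> \<le> (ln (15 / 2))\<^sup>2 / 72"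
  shows "\<not> (\<exists>C::real. 0 < C \<and>
            (\<exists>N::nat. \<forall>(G::nat pair_pre_digraph) (d::nat).
               pair_graph G \<and> N \<le> card (pverts G) \<and> regular d G \<and> expander \<epsilon> (real d) G \<and>
               C * (ln (real (card (pverts G))))\<^sup>2 \<le> real d \<longrightarrow> hamiltonian G))
       \<and> (\<exists>(G :: nat \<Rightarrow> nat pair_pre_digraph) (d :: nat \<Rightarrow> nat) (n :: nat \<Rightarrow> nat).
            (\<forall>k. pair_graph (G k) \<and> card (pverts (G k)) = n k \<and> regular (d k) (G k) \<and>
                 expander \<epsilon> (real (d k)) (G k) \<and> \<not> hamiltonian (G k)) \<and>
            filterlim n at_top sequentially \<and>
            (\<lambda>k. real (d k) / real (n k)) \<longlonglongrightarrow> 0 \<and>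
            filterlim (\<lambda>k. real (d k) / (ln (real (n k)))\<^sup>2) at_top sequentially)"
    (is "?no_constant \<and> ?sequence")
proof
  have "\<forall>k. \<exists>P::nat. prime P \<and> k + 200 < P" using bigger_prime by blast
  then obtain P :: "nat \<Rightarrow> nat" where P: "\<And>k. prime (P k)" "\<And>k. k + 200 < P k" by metis
  \<comment> \<open>Rounding P/4 down makes \<open>4 * Q k\<close> differ from \<open>P k\<close> by
    less than 4, so the degree is close to P and the order of the graph close to 2 P^2.\<close>
  define Q where "Q k = P k div 4" for k
  define n where "n k = 8 * Q k * P k + 8 * Q k + 1" for k
  have Q: "25 \<le> Q k" "4 * Q k \<le> P k" "P k \<le> 4 * Q k + 4" for k
    using P(2)[of k] by (auto simp: Q_def)
  have pg: "plane_graph (P k) (Q k)" for k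
    using P Q[of k] by unfold_locales auto
  define G where "G k = plane_graph.H (P k) (Q k)" for k
  have G: "pair_graph (G k)" "card (pverts (G k)) = n k" "regular (4 * Q k) (G k)"
      "expander \<epsilon> (real (4 * Q k)) (G k)" "\<not> hamiltonian (G k)" for k
    unfolding G_def n_def
    using plane_graph.pair_graph_H[OF pg] plane_graph.card_pverts_H[OF pg]
      plane_graph.regular_H[OF pg] plane_graph.expander_H[OF pg Q(1) Q(3) assms]
      plane_graph.not_hamiltonian_H[OF pg]
    by simp_all
  have P_top: "filterlim P at_top sequentially"
  proof (rule filterlim_at_top_mono[OF filterlim_ident])
    have "k \<le> P k" for k using P(2)[of k] by linarith
    then show "\<forall>\<^sub>F k in sequentially. k \<le> P k" by simp
  qed
  then have P_real: "filterlim (\<lambda>k. real (P k)) at_top sequentially"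
    by (rule filterlim_compose[OF filterlim_real_sequentially])
  have Pn: "P k \<le> n k" for k
  proof -
    have "1 * P k \<le> 8 * Q k * P k" using Q(1)[of k] by (intro mult_right_mono) auto
    then show ?thesis unfolding n_def by linarith
  qed
  have n_top: "filterlim n at_top sequentially"
    by (rule filterlim_at_top_mono[OF P_top]) (simp add: Pn)
  have dn: "(\<lambda>k. real (4 * Q k) / real (n k)) \<longlonglongrightarrow> 0"
  proof (rule tendsto_sandwich[OF _ _ tendsto_const])
    show "((\<lambda>k. 1 / real (P k)) \<longlongrightarrow> 0) sequentially"
      using P_real by (rule filterlim_compose[rotated]) real_asymp
    have "real (4 * Q k) / real (n k) \<le> 1 / real (P k)" for k
    proof -
      have "4 * Q k * P k \<le> n k" by (simp add: n_def)
      then have "real (4 * Q k * P k) \<le> real (n k)" by (simp only: of_nat_le_iff)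
      then have "real (4 * Q k) * real (P k) \<le> real (n k)" by (simp only: of_nat_mult)
      moreover have "0 < P k" "0 < n k" using P(2)[of k] Pn[of k] by linarith+
      ultimately show ?thesis by (simp add: pos_divide_le_eq pos_le_divide_eq)
    qed
    then show "\<forall>\<^sub>F k in sequentially. real (4 * Q k) / real (n k) \<le> 1 / real (P k)" by simp
  qed simp
  have dlog: "filterlim (\<lambda>k. real (4 * Q k) / (ln (real (n k)))\<^sup>2) at_top sequentially"
  proof (rule filterlim_at_top_mono)
    \<comment> \<open>The comparison uses d \<ge> P - 4 and the generous bound n \<le> 5
      P^2.\<close>
    show "filterlim (\<lambda>k. (real (P k) - 4) / (ln (5 * (real (P k))\<^sup>2))\<^sup>2) at_top sequentially"
      using P_real by (rule filterlim_compose[rotated]) real_asymp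
    have "(real (P k) - 4) / (ln (5 * (real (P k))\<^sup>2))\<^sup>2 \<le> real (4 * Q k) / (ln (real (n k)))\<^sup>2" for k
    proof (rule frac_le)
      show "real (P k) - 4 \<le> real (4 * Q k)" using Q(3)[of k] by linarith
      have n1: "1 < n k" using Pn[of k] P(2)[of k] by linarith
      then show "0 < (ln (real (n k)))\<^sup>2" by simp
      have "4 * Q k * P k \<le> P k * P k" using Q(2) by (rule mult_right_mono) simp
      moreover have "3 * P k \<le> P k * P k" using P(2)[of k] by (intro mult_right_mono) auto
      ultimately have "n k \<le> 5 * (P k)\<^sup>2"
        using Q(2)[of k] P(2)[of k] unfolding n_def power2_eq_square by linarith
      then have "real (n k) \<le> real (5 * (P k)\<^sup>2)" by (simp only: of_nat_le_iff)
      then have "ln (real (n k)) \<le> ln (5 * (real (P k))\<^sup>2)"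
        using n1 by (intro ln_mono) auto
      then show "(ln (real (n k)))\<^sup>2 \<le> (ln (5 * (real (P k))\<^sup>2))\<^sup>2"
        using n1 by (intro power_mono) auto
    qed simp
    then show "\<forall>\<^sub>F k in sequentially. (real (P k) - 4) / (ln (5 * (real (P k))\<^sup>2))\<^sup>2
        \<le> real (4 * Q k) / (ln (real (n k)))\<^sup>2" by simp
  qed
  show ?sequence
    by (rule exI[of _ G], rule exI[of _ "\<lambda>k. 4 * Q k"], rule exI[of _ n])
      (use G n_top dn dlog in blast)
  show ?no_constant
  proof (intro notI, elim exE conjE)
    fix C :: real and N :: nat
    assume all: "\<forall>(G::nat pair_pre_digraph) (d::nat).
      pair_graph G \<and> N \<le> card (pverts G) \<and> regular d G \<and> expander \<epsilon> (real d) G \<and>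
      C * (ln (real (card (pverts G))))\<^sup>2 \<le> real d \<longrightarrow> hamiltonian G"
    \<comment> \<open>Since n and d / log^2 n tend to infinity, they eventually exceed any proposed
      \<open>N\<close> and \<open>C\<close>, and the nonhamiltonian \<open>G k\<close> refutes
      them.\<close>
    have "\<forall>\<^sub>F k in sequentially. N \<le> n k \<and> C \<le> real (4 * Q k) / (ln (real (n k)))\<^sup>2"
      using n_top dlog by (auto simp: filterlim_at_top intro: eventually_conj)
    then obtain k where k: "N \<le> n k" "C \<le> real (4 * Q k) / (ln (real (n k)))\<^sup>2"
      by (auto simp: eventually_sequentially)
    have "1 < n k" using Pn[of k] P(2)[of k] by linarith
    then have "C * (ln (real (n k)))\<^sup>2 \<le> real (4 * Q k)"
      using k(2) by (simp add: pos_le_divide_eq)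
    then show False using all G[of k] k(1) by metis
  qed
qed

end
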